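(* Let $d_n$ be a semimetric on $\Theta$, $\varepsilon_n>0$, $\varepsilon_n\to0$, $(n\varepsilon_n^2)^{-1}=O(1)$, $k>1$, $K>0$, $\Theta_n\subset\Theta$, and let $\phi_n$ be a sequence of test functions such that $P_{\theta_0}^{(n)}\phi_n\to0$ and, for every sufficiently large $j\in\mathbb{N}$ (and all $n$), $$\sup_{\theta\in\Theta_n:\,j\varepsilon_n<d_n(\theta,\theta_0)\le2j\varepsilon_n}P_\theta^{(n)}(1-\phi_n)\lesssim e^{-Kj^2n\varepsilon_n^2},$$ $$\frac{\Pi_n(\theta\in\Theta_n:j\varepsilon_n<d_n(\theta,\theta_0)\le2j\varepsilon_n)}{\Pi_n(B_n(\theta_0,\varepsilon_n;k))}\le e^{Kn\varepsilon_n^2j^2/2}.$$ Then for every $M_n\to\infty$, $$P_{\theta_0}^{(n)}\Pi_n(\theta\in\Theta_n:d_n(\theta,\theta_0)\ge M_n\varepsilon_n\mid X^{(n)})\to0.$$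
   Context: For each $n\in\mathbb{N}$, $(\mathfrak{X}^{(n)},\mathcal{A}^{(n)},P_\theta^{(n)}:\theta\in\Theta)$ is a statistical experiment with observation $X^{(n)}$; the parameter set $\Theta$ is arbitrary, equipped with a $\sigma$-field $\mathcal{B}$. Each $P_\theta^{(n)}$ has a density $p_\theta^{(n)}$ relative to a $\sigma$-finite measure $\mu^{(n)}$, and $(x,\theta)\mapsto p_\theta^{(n)}(x)$ is jointly measurable. $\Pi_n$ is a prior probability measure on $(\Theta,\mathcal{B})$ and the posterior is $$\Pi_n(B\mid X^{(n)})=\frac{\int_Bp_\theta^{(n)}(X^{(n)})\,d\Pi_n(\theta)}{\int_\Theta p_\theta^{(n)}(X^{(n)})\,d\Pi_n(\theta)},\quad B\in\mathcal{B}.$$ The point $\theta_0\in\Theta$ is fixed (the true parameter). $Pf$ abbreviates $\int f\,dP$. A test is a measurable function of the observation with values in $[0,1]$. All sets to which priors and posteriors are applied are taken to be measurable. For densities $f,g$ relative to $\mu$: $K(f,g)=\int f\log(f/g)\,d\mu$ and $V_{k,0}(f,g)=\int f\,|\log(f/g)-K(f,g)|^k\,d\mu$. For $k>1$, $\varepsilon>0$, $$B_n(\theta_0,\varepsilon;k)=\{\theta\in\Theta:K(p_{\theta_0}^{(n)},p_\theta^{(n)})\le n\varepsilon^2,\ V_{k,0}(p_{\theta_0}^{(n)},p_\theta^{(n)})\le n^{k/2}\varepsilon^k\}.$$ $\lesssim$ denotes inequality up to a multiplicative constant that is fixed throughout (not depending on $n$ or $j$). *)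

theory Defs
  imports "HOL-Probability.Probability" "HOL-Library.Landau_Symbols"
begin

(* The sample space is space M, the parameter set with its sigma-field is T. *)
locale dominated_experiment = sigma_finite_measure M
  for M :: "'x measure" +
  fixes T :: "'t measure" and P :: "'t \<Rightarrow> 'x measure" and p :: "'t \<Rightarrow> 'x \<Rightarrow> real"
  assumes prob_space_P: "\<theta> \<in> space T \<Longrightarrow> prob_space (P \<theta>)"
    and P_eq_density: "\<theta> \<in> space T \<Longrightarrow> P \<theta> = density M (\<lambda>x. ennreal (p \<theta> x))"
    and p_nonneg: "\<theta> \<in> space T \<Longrightarrow> x \<in> space M \<Longrightarrow> 0 \<le> p \<theta> x"
    and p_measurable: "(\<lambda>(x, \<theta>). p \<theta> x) \<in> borel_measurable (M \<Otimes>\<^sub>M T)"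

definition posterior :: "'t measure \<Rightarrow> ('t \<Rightarrow> 'x \<Rightarrow> real) \<Rightarrow> 'x \<Rightarrow> 't set \<Rightarrow> ennreal" where
  "posterior prior p x B =
    (\<integral>\<^sup>+\<theta>\<in>B. ennreal (p \<theta> x) \<partial>prior) / (\<integral>\<^sup>+\<theta>. ennreal (p \<theta> x) \<partial>prior)"

(* The logarithm of a / b for a, b >= 0, extended by its limits.  The value at a = 0 is
   irrelevant below, because it only occurs multiplied by a. *)
definition log_ratio :: "real \<Rightarrow> real \<Rightarrow> ereal" where
  "log_ratio a b = (if a = 0 then - \<infinity> else if b = 0 then \<infinity> else ereal (ln (a / b)))"

(* Integral of an extended real function as positive part minus negative part.  The function
   e2ennreal maps negative arguments to 0. *)
definition ereal_integral :: "'x measure \<Rightarrow> ('x \<Rightarrow> ereal) \<Rightarrow> ereal" where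
  "ereal_integral M h =
    enn2ereal (\<integral>\<^sup>+x. e2ennreal (h x) \<partial>M) - enn2ereal (\<integral>\<^sup>+x. e2ennreal (- h x) \<partial>M)"

(* KL_divergence of HOL-Probability is real-valued and equals 0 when the log-likelihood ratio is
   not integrable.  Here the value is then infinity; for probability densities the negative part
   always has a finite integral. *)
definition KL :: "'x measure \<Rightarrow> ('x \<Rightarrow> real) \<Rightarrow> ('x \<Rightarrow> real) \<Rightarrow> ereal" where
  "KL M f g = ereal_integral M (\<lambda>x. ereal (f x) * log_ratio (f x) (g x))"

definition abs_powr :: "ereal \<Rightarrow> real \<Rightarrow> ereal" where
  "abs_powr y k = (if \<bar>y\<bar> = \<infinity> then \<infinity> else ereal (\<bar>real_of_ereal y\<bar> powr k))"

definition KL_variation :: "'x measure \<Rightarrow> real \<Rightarrow> ('x \<Rightarrow> real) \<Rightarrow> ('x \<Rightarrow> real) \<Rightarrow> ereal" where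
  "KL_variation M k f g =
    ereal_integral M (\<lambda>x. ereal (f x) * abs_powr (log_ratio (f x) (g x) - KL M f g) k)"

definition KL_ball ::
    "'x measure \<Rightarrow> 't measure \<Rightarrow> ('t \<Rightarrow> 'x \<Rightarrow> real) \<Rightarrow> nat \<Rightarrow> 't \<Rightarrow> real \<Rightarrow> real \<Rightarrow> 't set" where
  "KL_ball M T p n \<theta>0 \<epsilon> k =
    {\<theta> \<in> space T. KL M (p \<theta>0) (p \<theta>) \<le> ereal (real n * \<epsilon>\<^sup>2) \<and>
      KL_variation M k (p \<theta>0) (p \<theta>) \<le> ereal (real n powr (k / 2) * \<epsilon> powr k)}"

(* Distinct points may have distance 0. *)
definition semimetric_on :: "'t set \<Rightarrow> ('t \<Rightarrow> 't \<Rightarrow> real) \<Rightarrow> bool" where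
  "semimetric_on S d \<longleftrightarrow>
    (\<forall>x\<in>S. d x x = 0) \<and>
    (\<forall>x\<in>S. \<forall>y\<in>S. 0 \<le> d x y \<and> d x y = d y x) \<and>
    (\<forall>x\<in>S. \<forall>y\<in>S. \<forall>z\<in>S. d x z \<le> d x y + d y z)"

definition is_test :: "'x measure \<Rightarrow> ('x \<Rightarrow> real) \<Rightarrow> bool" where
  "is_test M \<phi> \<longleftrightarrow> \<phi> \<in> borel_measurable M \<and> (\<forall>x\<in>space M. 0 \<le> \<phi> x \<and> \<phi> x \<le> 1)"

end

theory Submission
  imports Defs "HOL-Real_Asymp.Real_Asymp"
begin

text \<open>Bound the posterior mass by the test, by the event that the evidence
  \<open>\<integral> p \<theta> x \<partial>\<Pi>\<close> is small compared with \<open>p \<theta>0 x\<close>, and by the type II errors integrated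
  over the prior. With \<open>s = n \<epsilon>\<^sup>2\<close>, the evidence is at least
  \<open>exp (- (1 + C) * s) * \<Pi> B / 2\<close> times \<open>p \<theta>0 x\<close> with probability at least
  \<open>1 - 2 / (C powr k * s powr (k / 2))\<close>, where \<open>B\<close> is the Kullback-Leibler ball. On that event
  the shells \<open>j \<ge> J\<close> contribute a geometric tail, once \<open>K * J\<^sup>2 / 4 \<ge> 1 + C\<close>. As \<open>s\<close> is only bounded
  away from \<open>0\<close>, both \<open>C\<close> and then \<open>J\<close> have to be chosen large, before letting
  \<open>n\<close> tend to infinity.\<close>

section \<open>Quotients and weighted union bounds in \<open>ennreal\<close>\<close>

lemma ennreal_inverse_mult_le:
  fixes q D f :: ennreal
  assumes "q * f \<le> D" "q \<noteq> 0" "q \<noteq> \<top>" "f \<noteq> \<top>"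
  shows "inverse D * f \<le> inverse q"
\<comment> \<open>In the first case the left side is 0, as \<open>inverse \<top> = 0\<close>.
  Otherwise everything is real, and \<open>q * f > 0\<close> forces \<open>D > 0\<close>, so
  ordinary division applies.\<close>
proof (cases "f = 0 \<or> D = \<top>")
  case False
  from assms obtain r where r: "q = ennreal r" "r > 0"
    by (cases q) (auto simp: order.strict_iff_order)
  from assms False obtain t where t: "f = ennreal t" "t > 0"
    by (cases f) (auto simp: order.strict_iff_order)
  from False obtain e where e: "D = ennreal e" "e \<ge> 0"
    by (cases D) auto
  have "r * t \<le> e"
    using assms(1) r t e by (simp add: ennreal_mult'[symmetric])
  moreover from this have "0 < e"
    using mult_pos_pos[OF r(2) t(2)] by linarith
  ultimately show ?thesis
    using r t e by (auto simp: inverse_ennreal ennreal_mult'[symmetric] field_simps)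
qed auto

text \<open>The conventions \<open>0 / 0 = 0\<close> and \<open>a / \<top> = 0\<close> settle the
  degenerate denominators, so a posterior is at most 1 even where its normalising integral is 0 or
  infinite.\<close>

lemma ennreal_divide_le_1:
  fixes a b :: ennreal
  assumes "a \<le> b"
  shows "a / b \<le> 1"
  using assms
  by (cases "b = 0"; cases "b = \<top>")
    (auto simp: top.not_eq_extremum zero_less_iff_neq_zero intro!: divide_le_posI_ennreal)

lemma posterior_le_1: "posterior Q p x A \<le> 1"
  unfolding posterior_def
  by (intro ennreal_divide_le_1 nn_integral_mono) (auto split: split_indicator)

text \<open>At a point of \<open>A\<close>, the term of one \<open>S i\<close> containing it already
  dominates \<open>f\<close>; overlaps of the sets only enlarge the right side. This suits the
  shells used later, which do overlap.\<close>

lemma set_nn_integral_le_suminf: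
  fixes w :: "nat \<Rightarrow> ennreal"
  assumes S: "\<And>i. S i \<in> sets Q" and cover: "A \<subseteq> (\<Union>i. S i)"
    and le: "\<And>i \<theta>. \<theta> \<in> S i \<Longrightarrow> f \<theta> \<le> w i"
  shows "(\<integral>\<^sup>+\<theta>\<in>A. f \<theta> \<partial>Q) \<le> (\<Sum>i. w i * emeasure Q (S i))"
proof -
  have "(\<integral>\<^sup>+\<theta>\<in>A. f \<theta> \<partial>Q) \<le> (\<integral>\<^sup>+\<theta>. (\<Sum>i. w i * indicator (S i) \<theta>) \<partial>Q)"
  proof (intro nn_integral_mono)
    fix \<theta>
    show "f \<theta> * indicator A \<theta> \<le> (\<Sum>i. w i * indicator (S i) \<theta>)"
    proof (cases "\<theta> \<in> A")
      case True
      then obtain i where i: "\<theta> \<in> S i" using cover by auto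
      have "f \<theta> * indicator A \<theta> \<le> (\<Sum>i\<in>{i}. w i * indicator (S i) \<theta>)" using i True le by simp
      also have "\<dots> \<le> (\<Sum>i. w i * indicator (S i) \<theta>)" by (rule sum_le_suminf) auto
      finally show ?thesis .
    qed simp
  qed
  also have "\<dots> = (\<Sum>i. \<integral>\<^sup>+\<theta>. w i * indicator (S i) \<theta> \<partial>Q)"
    using S by (intro nn_integral_suminf) auto
  also have "\<dots> = (\<Sum>i. w i * emeasure Q (S i))"
    using S by (simp add: nn_integral_cmult_indicator)
  finally show ?thesis .
qed

section \<open>Densities and the deviation of the log-likelihood ratio\<close>

context dominated_experiment
begin

lemma sets_P [simp]: "\<theta> \<in> space T \<Longrightarrow> sets (P \<theta>) = sets M"
  and space_P [simp]: "\<theta> \<in> space T \<Longrightarrow> space (P \<theta>) = space M"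
  by (simp_all add: P_eq_density)

lemma borel_measurable_p: "\<theta> \<in> space T \<Longrightarrow> p \<theta> \<in> borel_measurable M"
  using measurable_compose[OF measurable_Pair2' p_measurable, of \<theta>] by simp

lemma nn_integral_P:
  assumes "\<theta> \<in> space T" "f \<in> borel_measurable M"
  shows "(\<integral>\<^sup>+x. f x \<partial>P \<theta>) = (\<integral>\<^sup>+x. ennreal (p \<theta> x) * f x \<partial>M)"
  using assms borel_measurable_p[OF assms(1)] by (simp add: P_eq_density nn_integral_density)

text \<open>On the event, \<open>log (p \<theta>0 / p \<theta>)\<close> exceeds \<open>s + b\<close>, and hence its mean by \<open>b\<close>; the bound is
  Markov's inequality. Infinite values of the log-likelihood ratio are covered.\<close>

lemma likelihood_ratio_small_prob:
  assumes \<theta>0: "\<theta>0 \<in> space T" and \<theta>: "\<theta> \<in> space T"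
    and KL: "KL M (p \<theta>0) (p \<theta>) \<le> ereal s"
    and V: "KL_variation M k (p \<theta>0) (p \<theta>) \<le> ereal v"
    and b: "b > 0" and k: "k > 0"
  shows "emeasure (P \<theta>0) {x\<in>space M. p \<theta> x < exp (- (s + b)) * p \<theta>0 x} \<le> ennreal (v / b powr k)"
proof -
  let ?E = "{x\<in>space M. p \<theta> x < exp (- (s + b)) * p \<theta>0 x}"
  let ?y = "\<lambda>x. log_ratio (p \<theta>0 x) (p \<theta> x) - KL M (p \<theta>0) (p \<theta>)"
  let ?h = "\<lambda>x. ereal (p \<theta>0 x) * abs_powr (?y x) k"
  note [measurable] = borel_measurable_p[OF \<theta>0] borel_measurable_p[OF \<theta>]
  have E [measurable]: "?E \<in> sets M" by measurable
  have pos: "abs_powr y k \<ge> 0" for y by (simp add: abs_powr_def)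
  have hpos: "0 \<le> ?h x" if "x \<in> space M" for x
    using p_nonneg[OF \<theta>0 that] pos by simp
  \<comment> \<open>The integrand \<open>?h\<close> has no negative part, so
    \<open>ereal_integral\<close> reduces to a nonnegative integral and \<open>V\<close> bounds the
    latter.\<close>
  have "(\<integral>\<^sup>+x. e2ennreal (- ?h x) \<partial>M) = (\<integral>\<^sup>+x. 0 \<partial>M)"
    by (intro nn_integral_cong e2ennreal_neg) (use hpos in auto)
  then have "enn2ereal (\<integral>\<^sup>+x. e2ennreal (?h x) \<partial>M) \<le> ereal v"
    using V by (simp add: KL_variation_def ereal_integral_def zero_ennreal.rep_eq)
  then have V': "(\<integral>\<^sup>+x. e2ennreal (?h x) \<partial>M) \<le> ennreal v"
    by (metis e2ennreal_enn2ereal e2ennreal_mono e2ennreal_ereal)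
  have big: "ereal (b powr k) \<le> abs_powr (?y x) k" if "x \<in> ?E" for x
  proof -
    from that have x: "x \<in> space M" "p \<theta> x < exp (- (s + b)) * p \<theta>0 x" by auto
    have "p \<theta> x \<ge> 0" "p \<theta>0 x \<ge> 0" using p_nonneg \<theta> \<theta>0 x by auto
    \<comment> \<open>If \<open>p \<theta>0 x\<close> were 0, the strict inequality would make
      \<open>p \<theta> x\<close> negative.\<close>
    with x have f: "p \<theta>0 x > 0" by (cases "p \<theta>0 x = 0") auto
    have L: "ereal (s + b) \<le> log_ratio (p \<theta>0 x) (p \<theta> x)"
    proof (cases "p \<theta> x = 0")
      case False
      with \<open>p \<theta> x \<ge> 0\<close> have g: "p \<theta> x > 0" by simp
      have "exp (s + b) \<le> p \<theta>0 x / p \<theta> x"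
        using x(2) g by (simp add: exp_minus exp_add exp_diff field_simps del: mult_exp_exp)
      then have "s + b \<le> ln (p \<theta>0 x / p \<theta> x)"
        using f g by (simp add: ln_ge_iff)
      then show ?thesis using f g by (simp add: log_ratio_def)
    qed (use f in \<open>simp add: log_ratio_def\<close>)
    \<comment> \<open>By \<open>L\<close> the log ratio is real or \<open>\<infinity>\<close>, and
      by \<open>KL\<close> the divergence is real or \<open>-\<infinity>\<close>; hence the
      difference is never of the form infinity minus infinity.\<close>
    have "ereal b \<le> ?y x"
      using L KL by (cases "log_ratio (p \<theta>0 x) (p \<theta> x)"; cases "KL M (p \<theta>0) (p \<theta>)") auto
    then show ?thesis
      using b k by (cases "?y x") (auto simp: abs_powr_def intro!: powr_mono2)
  qed
  have "ennreal (b powr k) * emeasure (P \<theta>0) ?E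
      = ennreal (b powr k) * (\<integral>\<^sup>+x. ennreal (p \<theta>0 x) * indicator ?E x \<partial>M)"
    using \<theta>0 by (simp add: P_eq_density emeasure_density)
  also have "\<dots> = (\<integral>\<^sup>+x. ennreal (b powr k) * (ennreal (p \<theta>0 x) * indicator ?E x) \<partial>M)"
    by (rule nn_integral_cmult[symmetric]) measurable
  also have "\<dots> \<le> (\<integral>\<^sup>+x. e2ennreal (?h x) \<partial>M)"
  proof (rule nn_integral_mono)
    fix x assume x: "x \<in> space M"
    show "ennreal (b powr k) * (ennreal (p \<theta>0 x) * indicator ?E x) \<le> e2ennreal (?h x)"
    proof (cases "x \<in> ?E")
      case True
      have "ennreal (b powr k) * ennreal (p \<theta>0 x) = e2ennreal (ereal (p \<theta>0 x) * ereal (b powr k))"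
        using p_nonneg[OF \<theta>0 x] by (simp add: e2ennreal_ereal ennreal_mult'[symmetric] mult.commute)
      also have "\<dots> \<le> e2ennreal (?h x)"
        using p_nonneg[OF \<theta>0 x] big[OF True]
        by (intro e2ennreal_mono ereal_mult_left_mono) auto
      finally show ?thesis using True by simp
    qed auto
  qed
  finally have le: "ennreal (b powr k) * emeasure (P \<theta>0) ?E \<le> ennreal v" using V' by order
  have "emeasure (P \<theta>0) ?E = ennreal (inverse (b powr k)) * (ennreal (b powr k) * emeasure (P \<theta>0) ?E)"
    using b by (simp add: mult.assoc[symmetric] ennreal_mult'[symmetric])
  also have "\<dots> \<le> ennreal (inverse (b powr k)) * ennreal v"
    by (intro mult_left_mono le) auto
  also have "\<dots> = ennreal (v / b powr k)"
    by (subst ennreal_mult'[symmetric]) (auto simp: divide_inverse mult.commute)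
  finally show ?thesis .
qed

section \<open>Evidence and posterior under a fixed prior\<close>

context
  fixes Q :: "'t measure"
  assumes prob_Q: "prob_space Q" and sets_Q: "sets Q = sets T"
begin

interpretation Q: prob_space Q by (rule prob_Q)

interpretation MQ: pair_sigma_finite M Q ..

lemma space_Q: "space Q = space T"
  using sets_Q by (rule sets_eq_imp_space_eq)

lemma p_measurable_Q: "(\<lambda>(x, \<theta>). p \<theta> x) \<in> borel_measurable (M \<Otimes>\<^sub>M Q)"
  using p_measurable measurable_cong_sets[OF sets_pair_measure_cong[OF refl sets_Q] refl] by blast

text \<open>Joint measurability in composed form, so that the \<open>measurable\<close> method
  handles sections and swapped arguments of the density.\<close>

lemma p_measurable_Q' [measurable]:
  assumes [measurable]: "f \<in> N \<rightarrow>\<^sub>M M" "g \<in> N \<rightarrow>\<^sub>M Q"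
  shows "(\<lambda>z. p (g z) (f z)) \<in> borel_measurable N"
  using measurable_compose[OF measurable_Pair[OF assms] p_measurable_Q] by simp

lemma posterior_measurable [measurable]:
  assumes A [measurable]: "A \<in> sets Q"
  shows "(\<lambda>x. posterior Q p x A) \<in> borel_measurable M"
  unfolding posterior_def by measurable

text \<open>By Fubini and Markov, with probability at least \<open>1 - 2 * \<delta>\<close> at most half of the prior mass of
  \<open>B\<close> has a likelihood ratio below \<open>\<eta>\<close>. This replaces the usual argument through Jensen's
  inequality and needs no measurability of the Kullback-Leibler divergence in \<open>\<theta>\<close>.\<close>

lemma evidence_small_prob:
  assumes \<theta>0: "\<theta>0 \<in> space T" and B: "B \<in> sets T" and B_pos: "measure Q B > 0" and \<eta>: "\<eta> > 0"
    and small: "\<And>\<theta>. \<theta> \<in> B \<Longrightarrow> emeasure (P \<theta>0) {x\<in>space M. p \<theta> x < \<eta> * p \<theta>0 x} \<le> \<delta>"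
  shows "emeasure (P \<theta>0) {x\<in>space M. (\<integral>\<^sup>+\<theta>. ennreal (p \<theta> x) \<partial>Q) <
           ennreal (\<eta> * measure Q B / 2) * ennreal (p \<theta>0 x)} \<le> 2 * \<delta>"
proof -
  interpret P0: prob_space "P \<theta>0" using \<theta>0 by (rule prob_space_P)
  interpret PQ: pair_sigma_finite "P \<theta>0" Q ..
  let ?D = "\<lambda>x. \<integral>\<^sup>+\<theta>. ennreal (p \<theta> x) \<partial>Q"
  let ?S = "{x\<in>space M. ?D x < ennreal (\<eta> * measure Q B / 2) * ennreal (p \<theta>0 x)}"
  let ?bad = "\<lambda>x \<theta>. indicator {z\<in>space (M \<Otimes>\<^sub>M Q). snd z \<in> B \<and> p (snd z) (fst z) < \<eta> * p \<theta>0 (fst z)} (x, \<theta>) :: ennreal"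
  note [measurable] = borel_measurable_p[OF \<theta>0]
  have BQ [measurable]: "B \<in> sets Q" using B sets_Q by simp
  have bad_M: "case_prod ?bad \<in> borel_measurable (M \<Otimes>\<^sub>M Q)" by measurable
  have bad_P: "case_prod ?bad \<in> borel_measurable (P \<theta>0 \<Otimes>\<^sub>M Q)"
    using bad_M measurable_cong_sets[OF sets_pair_measure_cong[OF sets_P[OF \<theta>0] refl] refl] by blast
  have S [measurable]: "?S \<in> sets M" by measurable
  \<comment> \<open>If the bad parameters had at most half the mass of \<open>B\<close>, the
    remaining part of \<open>B\<close> alone would lift the evidence to the threshold in
    \<open>?S\<close>.\<close>
  have key: "ennreal (measure Q B / 2) * indicator ?S x \<le> (\<integral>\<^sup>+\<theta>. ?bad x \<theta> \<partial>Q)" if x: "x \<in> space M" for x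
  proof (cases "x \<in> ?S")
    case True
    have f: "p \<theta>0 x \<ge> 0" using p_nonneg \<theta>0 x by auto
    have D: "?D x < ennreal (\<eta> * measure Q B / 2 * p \<theta>0 x)"
      using True f \<eta> by (simp add: ennreal_mult'[symmetric])
    \<comment> \<open>Evidence and bad mass are both finite; as reals \<open>D\<close> and
      \<open>c\<close> they can be subtracted and cancelled.\<close>
    then obtain D where D': "?D x = ennreal D" "D \<ge> 0"
      by (cases "?D x" rule: ennreal_cases) auto
    have bad1: "(\<integral>\<^sup>+\<theta>. ?bad x \<theta> \<partial>Q) \<le> (\<integral>\<^sup>+\<theta>. 1 \<partial>Q)"
      by (intro nn_integral_mono) (auto split: split_indicator)
    then have "(\<integral>\<^sup>+\<theta>. ?bad x \<theta> \<partial>Q) \<noteq> \<top>"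
      by (auto simp: Q.emeasure_space_1 top_unique)
    then obtain c where c: "(\<integral>\<^sup>+\<theta>. ?bad x \<theta> \<partial>Q) = ennreal c" "c \<ge> 0"
      by (cases "\<integral>\<^sup>+\<theta>. ?bad x \<theta> \<partial>Q" rule: ennreal_cases) auto
    have "ennreal (\<eta> * p \<theta>0 x * measure Q B) = ennreal (\<eta> * p \<theta>0 x) * emeasure Q B"
      using f \<eta> by (simp add: Q.emeasure_eq_measure ennreal_mult)
    also have "\<dots> = (\<integral>\<^sup>+\<theta>. ennreal (\<eta> * p \<theta>0 x) * indicator B \<theta> \<partial>Q)"
      by (simp add: nn_integral_cmult_indicator)
    \<comment> \<open>A parameter in \<open>B\<close> is either bad or has
      \<open>p \<theta> x\<close> at least \<open>\<eta> * p \<theta>0 x\<close>.\<close>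
    also have "\<dots> \<le> (\<integral>\<^sup>+\<theta>. ennreal (p \<theta> x) + ennreal (\<eta> * p \<theta>0 x) * ?bad x \<theta> \<partial>Q)"
      using x by (intro nn_integral_mono)
        (auto split: split_indicator simp: space_pair_measure not_less intro: ennreal_leI)
    also have "\<dots> = ?D x + ennreal (\<eta> * p \<theta>0 x) * (\<integral>\<^sup>+\<theta>. ?bad x \<theta> \<partial>Q)"
      using x by (subst nn_integral_add) (auto simp: nn_integral_cmult)
    also have "\<dots> = ennreal (D + \<eta> * p \<theta>0 x * c)"
      using D' c f \<eta> by (simp add: ennreal_mult)
    finally have "\<eta> * p \<theta>0 x * measure Q B \<le> D + \<eta> * p \<theta>0 x * c"
      using D' c f \<eta> by (subst (asm) ennreal_le_iff) auto
    moreover have "D < \<eta> * measure Q B / 2 * p \<theta>0 x"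
      using D D' by (simp add: ennreal_less_iff)
    ultimately have "(\<eta> * p \<theta>0 x) * (measure Q B / 2) < (\<eta> * p \<theta>0 x) * c"
      by (simp add: algebra_simps)
    \<comment> \<open>The strict inequality also excludes that the nonnegative factor
      \<open>\<eta> * p \<theta>0 x\<close> is 0, so it cancels.\<close>
    then have "measure Q B / 2 < c"
      using f \<eta> by (metis mult_less_cancel_left_disj mult_nonneg_nonneg not_less less_imp_le)
    then show ?thesis using True c by (auto intro: ennreal_leI)
  qed simp
  have "ennreal (measure Q B / 2) * emeasure (P \<theta>0) ?S
      = (\<integral>\<^sup>+x. ennreal (measure Q B / 2) * indicator ?S x \<partial>P \<theta>0)"
    using \<theta>0 by (simp add: nn_integral_cmult_indicator)
  also have "\<dots> \<le> (\<integral>\<^sup>+x. \<integral>\<^sup>+\<theta>. ?bad x \<theta> \<partial>Q \<partial>P \<theta>0)"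
    using \<theta>0 key by (intro nn_integral_mono) auto
  \<comment> \<open>After the exchange \<open>\<theta>\<close> is fixed, and \<open>small\<close>
    bounds the inner probability for \<open>\<theta>\<close> in \<open>B\<close>; outside
    \<open>B\<close> it is 0.\<close>
  also have "\<dots> = (\<integral>\<^sup>+\<theta>. \<integral>\<^sup>+x. ?bad x \<theta> \<partial>P \<theta>0 \<partial>Q)"
    using bad_P by (rule PQ.Fubini'[symmetric])
  also have "\<dots> \<le> (\<integral>\<^sup>+\<theta>. \<delta> * indicator B \<theta> \<partial>Q)"
  proof (rule nn_integral_mono)
    fix \<theta> assume \<theta>: "\<theta> \<in> space Q"
    show "(\<integral>\<^sup>+x. ?bad x \<theta> \<partial>P \<theta>0) \<le> \<delta> * indicator B \<theta>"
    proof (cases "\<theta> \<in> B")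
      case True
      have [measurable]: "p \<theta> \<in> borel_measurable M"
        using \<theta> space_Q by (simp add: borel_measurable_p)
      have "(\<integral>\<^sup>+x. ?bad x \<theta> \<partial>P \<theta>0) = (\<integral>\<^sup>+x. indicator {x\<in>space M. p \<theta> x < \<eta> * p \<theta>0 x} x \<partial>P \<theta>0)"
        using \<theta> \<theta>0 True
        by (intro nn_integral_cong) (auto simp: space_pair_measure split: split_indicator)
      also have "\<dots> = emeasure (P \<theta>0) {x\<in>space M. p \<theta> x < \<eta> * p \<theta>0 x}"
        using \<theta>0 by (intro nn_integral_indicator) simp
      finally show ?thesis using small[OF True] True by simp
    qed simp
  qed
  also have "\<dots> = \<delta> * ennreal (measure Q B)"
    by (simp add: nn_integral_cmult_indicator Q.emeasure_eq_measure)
  finally have le: "ennreal (measure Q B / 2) * emeasure (P \<theta>0) ?S \<le> \<delta> * ennreal (measure Q B)" .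
  have "emeasure (P \<theta>0) ?S = ennreal (2 / measure Q B) * (ennreal (measure Q B / 2) * emeasure (P \<theta>0) ?S)"
    using B_pos by (simp add: mult.assoc[symmetric] ennreal_mult'[symmetric])
  also have "\<dots> \<le> ennreal (2 / measure Q B) * (\<delta> * ennreal (measure Q B))"
    by (intro mult_left_mono le) auto
  also have "\<dots> = ennreal (2 / measure Q B * measure Q B) * \<delta>"
    using B_pos by (subst ennreal_mult) (auto simp: mult_ac)
  also have "\<dots> = 2 * \<delta>" using B_pos by simp
  finally show ?thesis .
qed

text \<open>Where the evidence is small the posterior is bounded by 1. Elsewhere it is split with
  weights \<open>\<phi>\<close> and \<open>1 - \<phi>\<close>: the first part is at most
  \<open>\<phi>\<close>, and in the second \<open>p \<theta>0 x\<close> over the evidence is at most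
  \<open>1 / q\<close>, which leaves an integral over the prior of type II errors.\<close>

lemma posterior_mean_le:
  assumes \<theta>0: "\<theta>0 \<in> space T" and A: "A \<in> sets T" and \<phi>: "is_test M \<phi>" and q: "q > 0"
  shows "(\<integral>\<^sup>+x. posterior Q p x A \<partial>P \<theta>0)
    \<le> ennreal (\<integral>x. \<phi> x \<partial>P \<theta>0)
      + emeasure (P \<theta>0) {x\<in>space M. (\<integral>\<^sup>+\<theta>. ennreal (p \<theta> x) \<partial>Q) < ennreal q * ennreal (p \<theta>0 x)}
      + ennreal (1 / q) * (\<integral>\<^sup>+\<theta>\<in>A. ennreal (\<integral>x. 1 - \<phi> x \<partial>P \<theta>) \<partial>Q)"
proof -
  let ?D = "\<lambda>x. \<integral>\<^sup>+\<theta>. ennreal (p \<theta> x) \<partial>Q"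
  let ?N = "\<lambda>x. \<integral>\<^sup>+\<theta>. ennreal (p \<theta> x) * indicator A \<theta> \<partial>Q"
  let ?S = "{x\<in>space M. ?D x < ennreal q * ennreal (p \<theta>0 x)}"
  have [measurable]: "A \<in> sets Q" "\<phi> \<in> borel_measurable M" "p \<theta>0 \<in> borel_measurable M"
    using A \<phi> \<theta>0 borel_measurable_p by (auto simp: sets_Q is_test_def)
  have \<phi>01: "0 \<le> \<phi> x" "\<phi> x \<le> 1" if "x \<in> space M" for x
    using \<phi> that by (auto simp: is_test_def)
  have S [measurable]: "?S \<in> sets M" by measurable
  \<comment> \<open>The function \<open>g\<close> is the identity for the type I error and
    \<open>1 - t\<close> for the type II error.\<close>
  have test_int: "(\<integral>\<^sup>+x. ennreal (g (\<phi> x)) \<partial>P \<theta>) = ennreal (\<integral>x. g (\<phi> x) \<partial>P \<theta>)"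
    if \<theta>: "\<theta> \<in> space T" and g [measurable]: "g \<in> borel_measurable borel"
      and g01: "\<And>t. 0 \<le> t \<Longrightarrow> t \<le> 1 \<Longrightarrow> 0 \<le> g t \<and> g t \<le> 1" for \<theta> and g :: "real \<Rightarrow> real"
  proof (rule nn_integral_eq_integral)
    interpret P\<theta>: prob_space "P \<theta>" using \<theta> by (rule prob_space_P)
    have meas: "(\<lambda>x. g (\<phi> x)) \<in> borel_measurable (P \<theta>)"
      using \<theta> by (subst measurable_cong_sets[OF sets_P refl]) auto
    show "integrable (P \<theta>) (\<lambda>x. g (\<phi> x))"
      by (rule P\<theta>.integrable_const_bound[where B = 1]) (use \<theta> \<phi>01 g01 meas in auto)
    show "AE x in P \<theta>. 0 \<le> g (\<phi> x)" using \<theta> \<phi>01 g01 by auto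
  qed
  have point: "ennreal (p \<theta>0 x) * posterior Q p x A
      \<le> ennreal (p \<theta>0 x) * ennreal (\<phi> x) + ennreal (p \<theta>0 x) * indicator ?S x
        + ennreal (1 / q) * (ennreal (1 - \<phi> x) * ?N x)" if x: "x \<in> space M" for x
  proof (cases "x \<in> ?S")
    case True
    have "ennreal (p \<theta>0 x) * posterior Q p x A \<le> ennreal (p \<theta>0 x) * 1"
      by (intro mult_left_mono posterior_le_1) auto
    then show ?thesis using True by (auto intro: order_trans add_increasing add_increasing2)
  next
    case False
    then have D: "ennreal q * ennreal (p \<theta>0 x) \<le> ?D x" using x by (auto simp: not_less)
    \<comment> \<open>The true density is grouped with the reciprocal evidence, the factor that
      \<open>D\<close> controls.\<close>
    have "ennreal (p \<theta>0 x) * posterior Q p x A = ?N x * (inverse (?D x) * ennreal (p \<theta>0 x))"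
      by (simp add: posterior_def divide_ennreal_def mult_ac)
    also have "\<dots> \<le> ?N x * inverse (ennreal q)"
      by (intro mult_left_mono ennreal_inverse_mult_le[OF D]) (use q in auto)
    also have "inverse (ennreal q) = ennreal (1 / q)"
      using q by (simp add: inverse_ennreal inverse_eq_divide)
    finally have N: "ennreal (p \<theta>0 x) * posterior Q p x A \<le> ?N x * ennreal (1 / q)" .
    let ?L = "ennreal (p \<theta>0 x) * posterior Q p x A"
    have "?L = (ennreal (\<phi> x) + ennreal (1 - \<phi> x)) * ?L"
      using \<phi>01[OF x] by (simp flip: ennreal_plus)
    also have "\<dots> = ennreal (\<phi> x) * ?L + ennreal (1 - \<phi> x) * ?L" by (simp add: distrib_right)
    also have "\<dots> \<le> ennreal (\<phi> x) * (ennreal (p \<theta>0 x) * 1) + ennreal (1 - \<phi> x) * (?N x * ennreal (1 / q))"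
      by (intro add_mono mult_left_mono posterior_le_1 N) auto
    finally show ?thesis using False by (simp add: mult_ac)
  qed
  have "(\<integral>\<^sup>+x. posterior Q p x A \<partial>P \<theta>0) = (\<integral>\<^sup>+x. ennreal (p \<theta>0 x) * posterior Q p x A \<partial>M)"
    using \<theta>0 by (intro nn_integral_P) measurable
  also have "\<dots> \<le> (\<integral>\<^sup>+x. ennreal (p \<theta>0 x) * ennreal (\<phi> x) + ennreal (p \<theta>0 x) * indicator ?S x
        + ennreal (1 / q) * (ennreal (1 - \<phi> x) * ?N x) \<partial>M)"
    by (intro nn_integral_mono point)
  also have "\<dots> = (\<integral>\<^sup>+x. ennreal (p \<theta>0 x) * ennreal (\<phi> x) \<partial>M)
      + (\<integral>\<^sup>+x. ennreal (p \<theta>0 x) * indicator ?S x \<partial>M)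
      + ennreal (1 / q) * (\<integral>\<^sup>+x. ennreal (1 - \<phi> x) * ?N x \<partial>M)"
    by (simp add: nn_integral_add nn_integral_cmult)
  also have "(\<integral>\<^sup>+x. ennreal (p \<theta>0 x) * ennreal (\<phi> x) \<partial>M) = ennreal (\<integral>x. \<phi> x \<partial>P \<theta>0)"
    using test_int[OF \<theta>0, of "\<lambda>t. t"] \<theta>0 by (simp add: nn_integral_P)
  also have "(\<integral>\<^sup>+x. ennreal (p \<theta>0 x) * indicator ?S x \<partial>M) = emeasure (P \<theta>0) ?S"
    using \<theta>0 by (simp add: P_eq_density emeasure_density)
  also have "(\<integral>\<^sup>+x. ennreal (1 - \<phi> x) * ?N x \<partial>M)
      = (\<integral>\<^sup>+x. \<integral>\<^sup>+\<theta>. ennreal (1 - \<phi> x) * (ennreal (p \<theta> x) * indicator A \<theta>) \<partial>Q \<partial>M)"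
    by (intro nn_integral_cong nn_integral_cmult[symmetric]) measurable
  \<comment> \<open>Fubini turns the numerator density \<open>p \<theta> x\<close> into the law
    \<open>P \<theta>\<close> of the observation.\<close>
  also have "\<dots> = (\<integral>\<^sup>+\<theta>. \<integral>\<^sup>+x. ennreal (1 - \<phi> x) * (ennreal (p \<theta> x) * indicator A \<theta>) \<partial>M \<partial>Q)"
    by (intro MQ.Fubini'[symmetric]) measurable
  also have "\<dots> = (\<integral>\<^sup>+\<theta>\<in>A. ennreal (\<integral>x. 1 - \<phi> x \<partial>P \<theta>) \<partial>Q)"
  proof (intro nn_integral_cong)
    fix \<theta> assume "\<theta> \<in> space Q"
    then have \<theta>: "\<theta> \<in> space T" by (simp add: space_Q)
    note [measurable] = borel_measurable_p[OF \<theta>]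
    show "(\<integral>\<^sup>+x. ennreal (1 - \<phi> x) * (ennreal (p \<theta> x) * indicator A \<theta>) \<partial>M)
        = ennreal (\<integral>x. 1 - \<phi> x \<partial>P \<theta>) * indicator A \<theta>"
      using test_int[OF \<theta>, of "\<lambda>t. 1 - t"] \<theta>
      by (cases "\<theta> \<in> A") (simp_all add: nn_integral_P mult_ac)
  qed
  finally show ?thesis .
qed

text \<open>On shell \<open>j\<close> the evidence costs the exponent \<open>(1 + C) * s\<close>,
  the prior ratio costs \<open>K * s * j^2 / 2\<close>, and the test gains
  \<open>K * s * j^2\<close>. By \<open>J\<close> the net exponent is at most
  \<open>- K * s * j^2 / 4\<close>, hence at most \<open>- K * c * j / 4\<close>. The resulting
  bound involves \<open>c\<close> but not \<open>s\<close>, so one choice of \<open>C\<close> and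
  \<open>J\<close> serves all large \<open>n\<close>.\<close>

lemma posterior_tail_bound:
  fixes S :: "nat \<Rightarrow> 't set" and c s C C0 k K :: real and J :: nat
  defines "r \<equiv> exp (- (K * c / 4))"
  assumes \<theta>0: "\<theta>0 \<in> space T" and A: "A \<in> sets T" and B: "B \<in> sets T" and \<phi>: "is_test M \<phi>"
    and KL: "\<And>\<theta>. \<theta> \<in> B \<Longrightarrow> KL M (p \<theta>0) (p \<theta>) \<le> ereal s"
    and V: "\<And>\<theta>. \<theta> \<in> B \<Longrightarrow> KL_variation M k (p \<theta>0) (p \<theta>) \<le> ereal (s powr (k / 2))"
    and c: "0 < c" "c \<le> s" and pos: "k > 0" "K > 0" "C > 0" "C0 > 0"
    and J: "1 + C \<le> K * (real J)\<^sup>2 / 4"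
    and cover: "A \<subseteq> (\<Union>i. S (i + J))"
    and S: "\<And>j. j \<ge> J \<Longrightarrow> S j \<in> sets T"
    and test: "\<And>j \<theta>. j \<ge> J \<Longrightarrow> \<theta> \<in> S j \<Longrightarrow>
      (\<integral>x. 1 - \<phi> x \<partial>P \<theta>) \<le> C0 * exp (- K * (real j)\<^sup>2 * s)"
    and ratio: "\<And>j. j \<ge> J \<Longrightarrow>
      emeasure Q (S j) / emeasure Q B \<le> ennreal (exp (K * s * (real j)\<^sup>2 / 2))"
  shows "(\<integral>\<^sup>+x. posterior Q p x A \<partial>P \<theta>0)
    \<le> ennreal ((\<integral>x. \<phi> x \<partial>P \<theta>0) + 2 / (C powr k * c powr (k / 2)) + 2 * C0 * (r ^ J / (1 - r)))"
proof (cases "emeasure Q B = 0")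
  \<comment> \<open>A nonzero number divided by 0 is \<open>\<top>\<close>, so \<open>ratio\<close>
    forces every shell from \<open>J\<close> on to be null, and the posterior of \<open>A\<close>
    vanishes.\<close>
  case True
  have "S j \<in> null_sets Q" if "j \<ge> J" for j
    using ratio[OF that] S[OF that] True sets_Q by (auto split: if_splits simp: top_unique)
  then have "(\<Union>i. S (i + J)) \<in> null_sets Q" by (intro null_sets_UN) auto
  then have "A \<in> null_sets Q" using A cover sets_Q by (metis null_sets_subset)
  then have "posterior Q p x A = 0" for x
    by (simp add: posterior_def nn_integral_null_set)
  then show ?thesis by simp
next
  case False
  then have b: "measure Q B > 0"
    by (simp add: Q.emeasure_eq_measure zero_less_measure_iff)
  \<comment> \<open>The likelihood ratio level is \<open>exp (- (s + b))\<close> with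
    \<open>b = C * s\<close>; the half is the share of the mass of \<open>B\<close> that may be
    bad.\<close>
  define q where "q = exp (- (s + C * s)) * measure Q B / 2"
  have s: "s > 0" using c by simp
  have q: "q > 0" using b by (simp add: q_def)
  have r: "0 < r" "r < 1" using c pos by (auto simp: r_def)
  \<comment> \<open>With \<open>b = C * s\<close> the Markov bound decays like
    \<open>s powr (- k / 2)\<close>, so \<open>c \<le> s\<close> makes it uniform in
    \<open>s\<close>.\<close>
  have "s powr k = s powr (k / 2) * s powr (k / 2)" by (simp flip: powr_add)
  then have "s powr (k / 2) / (C * s) powr k = 1 / (C powr k * s powr (k / 2))"
    using s pos by (simp add: powr_mult)
  also have "\<dots> \<le> 1 / (C powr k * c powr (k / 2))"
    using c pos by (intro divide_left_mono mult_left_mono powr_mono2) auto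
  finally have \<delta>: "s powr (k / 2) / (C * s) powr k \<le> 1 / (C powr k * c powr (k / 2))" .
  have evidence: "emeasure (P \<theta>0) {x\<in>space M. (\<integral>\<^sup>+\<theta>. ennreal (p \<theta> x) \<partial>Q) < ennreal q * ennreal (p \<theta>0 x)}
      \<le> 2 * ennreal (1 / (C powr k * c powr (k / 2)))"
    unfolding q_def
  proof (rule evidence_small_prob[OF \<theta>0 B b])
    fix \<theta> assume \<theta>: "\<theta> \<in> B"
    then have "\<theta> \<in> space T" using B sets.sets_into_space by auto
    then show "emeasure (P \<theta>0) {x\<in>space M. p \<theta> x < exp (- (s + C * s)) * p \<theta>0 x}
        \<le> ennreal (1 / (C powr k * c powr (k / 2)))"
      using likelihood_ratio_small_prob[OF \<theta>0 _ KL[OF \<theta>] V[OF \<theta>], of "C * s"] s pos \<delta>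
      by (meson ennreal_leI mult_pos_pos order_trans)
  qed simp
  have shell: "ennreal (1 / q) * (ennreal (C0 * exp (- K * (real j)\<^sup>2 * s)) * emeasure Q (S j))
      \<le> ennreal (2 * C0 * r ^ j)" if j: "j \<ge> J" for j
  proof -
    have "measure Q (S j) / measure Q B \<le> exp (K * s * (real j)\<^sup>2 / 2)"
      using ratio[OF j] b by (simp add: Q.emeasure_eq_measure divide_ennreal)
    then have m: "measure Q (S j) \<le> exp (K * s * (real j)\<^sup>2 / 2) * measure Q B"
      using b by (simp add: field_simps)
    have j1: "(1 + C) * s \<le> K * (real j)\<^sup>2 / 4 * s"
    proof (rule mult_right_mono)
      have "K * (real J)\<^sup>2 / 4 \<le> K * (real j)\<^sup>2 / 4"
        using j pos by (intro divide_right_mono mult_left_mono power_mono) auto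
      then show "1 + C \<le> K * (real j)\<^sup>2 / 4" using J by linarith
    qed (use s in simp)
    \<comment> \<open>Replacing \<open>j^2\<close> by \<open>j\<close> in the exponent, and
      \<open>s\<close> by \<open>c\<close>, turns the shell bounds into a geometric
      sequence.\<close>
    have "real j \<le> (real j)\<^sup>2" by (cases j) (auto simp: power2_eq_square)
    then have "real j * (K * c / 4) \<le> (real j)\<^sup>2 * (K * s / 4)"
      using c pos by (intro mult_mono) auto
    with j1 have expo: "(s + C * s) - K * (real j)\<^sup>2 * s + K * s * (real j)\<^sup>2 / 2 \<le> real j * (- (K * c / 4))"
      by (simp add: algebra_simps)
    have "1 / q * (C0 * exp (- K * (real j)\<^sup>2 * s) * measure Q (S j))
        \<le> 1 / q * (C0 * exp (- K * (real j)\<^sup>2 * s) * (exp (K * s * (real j)\<^sup>2 / 2) * measure Q B))"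
      using q pos m by (intro mult_left_mono) auto
    also have "\<dots> = 2 * C0 * exp ((s + C * s) - K * (real j)\<^sup>2 * s + K * s * (real j)\<^sup>2 / 2)"
    proof -
      have q_inv: "1 / q = 2 * exp (s + C * s) / measure Q B"
        by (simp only: q_def exp_minus) (simp add: field_simps)
      have exp: "exp (x - y + z) = exp x * exp (- y) * exp z" for x y z :: real
        by (simp flip: exp_add)
      show ?thesis unfolding q_inv exp using b by (simp del: mult_exp_exp)
    qed
    also have "\<dots> \<le> 2 * C0 * exp (real j * (- (K * c / 4)))"
      using expo pos by (intro mult_left_mono) auto
    also have "\<dots> = 2 * C0 * r ^ j" by (simp only: r_def exp_of_nat_mult)
    finally have "1 / q * (C0 * exp (- K * (real j)\<^sup>2 * s) * measure Q (S j)) \<le> 2 * C0 * r ^ j" .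
    then show ?thesis
      using q pos by (simp add: Q.emeasure_eq_measure ennreal_leI flip: ennreal_mult')
  qed
  have "ennreal (1 / q) * (\<integral>\<^sup>+\<theta>\<in>A. ennreal (\<integral>x. 1 - \<phi> x \<partial>P \<theta>) \<partial>Q)
      \<le> ennreal (1 / q) * (\<Sum>i. ennreal (C0 * exp (- K * (real (i + J))\<^sup>2 * s)) * emeasure Q (S (i + J)))"
  proof (intro mult_left_mono set_nn_integral_le_suminf ennreal_leI)
    show "(\<integral>x. 1 - \<phi> x \<partial>P \<theta>) \<le> C0 * exp (- K * (real (i + J))\<^sup>2 * s)" if "\<theta> \<in> S (i + J)" for i \<theta>
      using that by (intro test) auto
  qed (use S sets_Q cover in auto)
  also have "\<dots> = (\<Sum>i. ennreal (1 / q) * (ennreal (C0 * exp (- K * (real (i + J))\<^sup>2 * s)) * emeasure Q (S (i + J))))"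
    by simp
  also have "\<dots> \<le> (\<Sum>i. ennreal (2 * C0 * r ^ (i + J)))"
    by (intro suminf_le shell) auto
  also have "\<dots> = ennreal (2 * C0 * (r ^ J / (1 - r)))"
  proof (rule suminf_ennreal_eq)
    have "(\<lambda>i. (2 * C0 * r ^ J) * r ^ i) sums ((2 * C0 * r ^ J) * (1 / (1 - r)))"
      using r by (intro sums_mult geometric_sums) simp
    then show "(\<lambda>i. 2 * C0 * r ^ (i + J)) sums (2 * C0 * (r ^ J / (1 - r)))"
      by (simp add: power_add mult_ac)
  qed (use r pos in simp)
  finally have alternative: "ennreal (1 / q) * (\<integral>\<^sup>+\<theta>\<in>A. ennreal (\<integral>x. 1 - \<phi> x \<partial>P \<theta>) \<partial>Q)
      \<le> ennreal (2 * C0 * (r ^ J / (1 - r)))" .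
  have "0 \<le> (\<integral>x. \<phi> x \<partial>P \<theta>0)"
    using \<phi> \<theta>0 by (intro integral_nonneg_AE) (auto simp: is_test_def)
  then have sum: "ennreal ((\<integral>x. \<phi> x \<partial>P \<theta>0) + 2 / (C powr k * c powr (k / 2)) + 2 * C0 * (r ^ J / (1 - r)))
      = ennreal (\<integral>x. \<phi> x \<partial>P \<theta>0) + ennreal (2 * (1 / (C powr k * c powr (k / 2))))
        + ennreal (2 * C0 * (r ^ J / (1 - r)))"
    using r pos by (subst ennreal_plus[symmetric]; simp)+
  have "ennreal (2 * (1 / (C powr k * c powr (k / 2)))) = 2 * ennreal (1 / (C powr k * c powr (k / 2)))"
    by (subst ennreal_mult) auto
  note sum = sum[unfolded this]
  show ?thesis
    unfolding sum
    by (intro order_trans[OF posterior_mean_le[OF \<theta>0 A \<phi> q]] add_mono order_refl evidence alternative)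
qed

end

end

section \<open>Shell decomposition and passage to the limit\<close>

lemma shells_cover:
  fixes x \<epsilon> :: real and J :: nat
  assumes \<epsilon>: "\<epsilon> > 0" and J: "J \<ge> 1" "real J * \<epsilon> < x"
  shows "\<exists>i. real (i + J) * \<epsilon> < x \<and> x \<le> 2 * real (i + J) * \<epsilon>"
proof -
  \<comment> \<open>This is the largest integer strictly below \<open>x / \<epsilon>\<close>; the
    floor would fail the strict inequality when \<open>x / \<epsilon>\<close> is an integer. Since
    \<open>j \<ge> 1\<close>, the bound \<open>j + 1\<close> is at most
    \<open>2 * j\<close>.\<close>
  define j where "j = nat (\<lceil>x / \<epsilon>\<rceil> - 1)"
  have x: "real J < x / \<epsilon>" using J \<epsilon> by (simp add: field_simps)
  then have "int J < \<lceil>x / \<epsilon>\<rceil>" by linarith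
  then have j: "J \<le> j" "real j < x / \<epsilon>" "x / \<epsilon> \<le> real j + 1"
    unfolding j_def by linarith+
  then have "x / \<epsilon> \<le> 2 * real j" using J by linarith
  then have "real j * \<epsilon> < x" "x \<le> 2 * real j * \<epsilon>"
    using j \<epsilon> by (simp_all add: field_simps)
  moreover have "j = (j - J) + J" using j by simp
  ultimately show ?thesis by metis
qed

text \<open>The supremum is taken in \<open>ereal\<close>, where an empty shell gives
  \<open>-\<infinity>\<close>; the ratio is taken in \<open>ennreal\<close>, where a null ball gives
  \<open>\<top>\<close> unless the shell is null too. The measurability assumptions are those for
  sets to which priors and posteriors are applied.\<close>

theorem theorem3:
  fixes T :: "'t measure"
    and \<mu> :: "nat \<Rightarrow> 'x measure"
    and P :: "nat \<Rightarrow> 't \<Rightarrow> 'x measure"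
    and p :: "nat \<Rightarrow> 't \<Rightarrow> 'x \<Rightarrow> real"
    and prior :: "nat \<Rightarrow> 't measure"
    and \<theta>0 :: 't
    and d :: "nat \<Rightarrow> 't \<Rightarrow> 't \<Rightarrow> real"
    and \<epsilon> :: "nat \<Rightarrow> real"
    and k K :: real
    and \<Theta> :: "nat \<Rightarrow> 't set"
    and \<phi> :: "nat \<Rightarrow> 'x \<Rightarrow> real"
    and M :: "nat \<Rightarrow> real"
  assumes dominated: "\<And>n. n \<ge> 1 \<Longrightarrow> dominated_experiment (\<mu> n) T (P n) (p n)"
    and prior: "\<And>n. n \<ge> 1 \<Longrightarrow> prob_space (prior n) \<and> sets (prior n) = sets T"
    and \<theta>0: "\<theta>0 \<in> space T"
    and semimetric: "\<And>n. n \<ge> 1 \<Longrightarrow> semimetric_on (space T) (d n)"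
    and \<epsilon>_pos: "\<And>n. n \<ge> 1 \<Longrightarrow> \<epsilon> n > 0"
    and \<epsilon>_lim: "\<epsilon> \<longlonglongrightarrow> 0"
    and \<epsilon>_rate: "(\<lambda>n. inverse (real n * (\<epsilon> n)\<^sup>2)) \<in> O(\<lambda>_. 1)"
    and k: "k > 1"
    and K: "K > 0"
    and sieve: "\<And>n. n \<ge> 1 \<Longrightarrow> \<Theta> n \<subseteq> space T"
    and test: "\<And>n. n \<ge> 1 \<Longrightarrow> is_test (\<mu> n) (\<phi> n)"
    and test_null: "(\<lambda>n. \<integral>x. \<phi> n x \<partial>P n \<theta>0) \<longlonglongrightarrow> 0"
    and test_alternative:
      "\<exists>C>0. \<forall>\<^sub>F j in sequentially. \<forall>n\<ge>1.
        (SUP \<theta>\<in>{\<theta>\<in>\<Theta> n. real j * \<epsilon> n < d n \<theta> \<theta>0 \<and> d n \<theta> \<theta>0 \<le> 2 * real j * \<epsilon> n}.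
            ereal (\<integral>x. 1 - \<phi> n x \<partial>P n \<theta>))
          \<le> ereal (C * exp (- K * (real j)\<^sup>2 * real n * (\<epsilon> n)\<^sup>2))"
    and prior_ratio:
      "\<forall>\<^sub>F j in sequentially. \<forall>n\<ge>1.
        emeasure (prior n)
            {\<theta>\<in>\<Theta> n. real j * \<epsilon> n < d n \<theta> \<theta>0 \<and> d n \<theta> \<theta>0 \<le> 2 * real j * \<epsilon> n}
          / emeasure (prior n) (KL_ball (\<mu> n) T (p n) n \<theta>0 (\<epsilon> n) k)
          \<le> ennreal (exp (K * real n * (\<epsilon> n)\<^sup>2 * (real j)\<^sup>2 / 2))"
    and shell_measurable:
      "\<forall>\<^sub>F j in sequentially. \<forall>n\<ge>1.
        {\<theta>\<in>\<Theta> n. real j * \<epsilon> n < d n \<theta> \<theta>0 \<and> d n \<theta> \<theta>0 \<le> 2 * real j * \<epsilon> n} \<in> sets T"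
    and ball_measurable:
      "\<And>n. n \<ge> 1 \<Longrightarrow> KL_ball (\<mu> n) T (p n) n \<theta>0 (\<epsilon> n) k \<in> sets T"
    and tail_measurable:
      "\<And>n. n \<ge> 1 \<Longrightarrow> {\<theta>\<in>\<Theta> n. d n \<theta> \<theta>0 \<ge> M n * \<epsilon> n} \<in> sets T"
    and M: "filterlim M at_top sequentially"
  shows "(\<lambda>n. \<integral>\<^sup>+x. posterior (prior n) (p n) x {\<theta>\<in>\<Theta> n. d n \<theta> \<theta>0 \<ge> M n * \<epsilon> n} \<partial>P n \<theta>0)
    \<longlonglongrightarrow> 0"
proof (rule tendsto_zero_ennreal)
  fix e :: real assume e: "0 < e"
  define S where "S n j = {\<theta>\<in>\<Theta> n. real j * \<epsilon> n < d n \<theta> \<theta>0 \<and> d n \<theta> \<theta>0 \<le> 2 * real j * \<epsilon> n}" for n j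
  obtain C1 where C1: "C1 > 0" "\<forall>\<^sub>F n in sequentially. norm (inverse (real n * (\<epsilon> n)\<^sup>2)) \<le> C1 * norm (1::real)"
    using landau_o.bigE[OF \<epsilon>_rate] by blast
  \<comment> \<open>The bound \<open>C1\<close> on the reciprocals of
    \<open>n * \<epsilon>^2\<close> becomes a positive lower bound for large
    \<open>n\<close>.\<close>
  define c where "c = 1 / C1"
  have c: "c > 0" using C1 by (simp add: c_def)
  have rate: "\<forall>\<^sub>F n in sequentially. c \<le> real n * (\<epsilon> n)\<^sup>2"
    using C1(2) eventually_ge_at_top[of 1]
  proof eventually_elim
    case (elim n)
    have "real n * (\<epsilon> n)\<^sup>2 > 0" using elim \<epsilon>_pos[of n] by simp
    then show ?case using elim C1(1) by (simp add: c_def field_simps)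
  qed
  obtain C0 where C0: "C0 > 0" and alternative: "\<forall>\<^sub>F j in sequentially. \<forall>n\<ge>1.
      (SUP \<theta>\<in>S n j. ereal (\<integral>x. 1 - \<phi> n x \<partial>P n \<theta>)) \<le> ereal (C0 * exp (- K * (real j)\<^sup>2 * real n * (\<epsilon> n)\<^sup>2))"
    using test_alternative unfolding S_def by blast
  define w where "w = c powr (k / 2)"
  have w: "w > 0" using c by (simp add: w_def)
  \<comment> \<open>As \<open>k > 1\<close> and \<open>C \<ge> 1\<close>, \<open>C powr k\<close> is
    at least \<open>C\<close>; and \<open>C * w\<close> exceeds \<open>6 / e\<close>, so the
    evidence term is below \<open>e / 3\<close>.\<close>
  define C where "C = 1 + 6 / (e * w)"
  have C: "C \<ge> 1" using e w by (simp add: C_def)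
  have "2 / (C powr k * w) \<le> 2 / (C * w)"
    using C w k powr_mono[of 1 k C] by (intro divide_left_mono mult_right_mono) auto
  also have "C * w = w + 6 / e" using e w by (simp add: C_def field_simps)
  also have "2 / (w + 6 / e) < e / 3"
    using e w by (simp add: divide_less_eq add_pos_pos distrib_left)
  finally have term2: "2 / (C powr k * w) < e / 3" .
  define r where "r = exp (- (K * c / 4))"
  have r: "0 < r" "r < 1" using K c by (auto simp: r_def)
  have "(\<lambda>J. 2 * C0 * (r ^ J / (1 - r))) \<longlonglongrightarrow> 2 * C0 * (0 / (1 - r))"
    using r by (intro tendsto_intros LIMSEQ_power_zero) auto
  then have term3: "\<forall>\<^sub>F J in sequentially. 2 * C0 * (r ^ J / (1 - r)) < e / 3"
    using e by (intro order_tendstoD) auto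
  have "filterlim (\<lambda>J. K * (real J)\<^sup>2 / 4) at_top sequentially"
    using K by real_asymp
  then have large: "\<forall>\<^sub>F J in sequentially. 1 + C \<le> K * (real J)\<^sup>2 / 4"
    unfolding filterlim_at_top by blast
  \<comment> \<open>This upgrades each property from eventually in \<open>j\<close> to all indices
    from some \<open>J\<close> on, as the sum over all shells requires.\<close>
  note ev = alternative[THEN eventually_all_ge_at_top] prior_ratio[THEN eventually_all_ge_at_top]
    shell_measurable[THEN eventually_all_ge_at_top]
  obtain J where J: "1 + C \<le> K * (real J)\<^sup>2 / 4" "2 * C0 * (r ^ J / (1 - r)) < e / 3" "J \<ge> 1"
    and alternative_J: "\<And>j n. j \<ge> J \<Longrightarrow> n \<ge> 1 \<Longrightarrow>
      (SUP \<theta>\<in>S n j. ereal (\<integral>x. 1 - \<phi> n x \<partial>P n \<theta>)) \<le> ereal (C0 * exp (- K * (real j)\<^sup>2 * real n * (\<epsilon> n)\<^sup>2))"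
    and ratio_J: "\<And>j n. j \<ge> J \<Longrightarrow> n \<ge> 1 \<Longrightarrow>
      emeasure (prior n) (S n j) / emeasure (prior n) (KL_ball (\<mu> n) T (p n) n \<theta>0 (\<epsilon> n) k)
        \<le> ennreal (exp (K * real n * (\<epsilon> n)\<^sup>2 * (real j)\<^sup>2 / 2))"
    and S_J: "\<And>j n. j \<ge> J \<Longrightarrow> n \<ge> 1 \<Longrightarrow> S n j \<in> sets T"
    using eventually_happens'[OF sequentially_bot
      eventually_conj[OF large eventually_conj[OF term3 eventually_conj[OF eventually_ge_at_top[of 1]
        eventually_conj[OF ev(1) eventually_conj[OF ev(2) ev(3)]]]]]]
    unfolding S_def by blast
  \<comment> \<open>With \<open>C\<close> and \<open>J\<close> fixed, \<open>n\<close> only has to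
    make the type I error less than the last third of \<open>e\<close>, \<open>M n\<close> larger
    than \<open>J\<close>, and \<open>n * \<epsilon>^2\<close> at least \<open>c\<close>.\<close>
  have "\<forall>\<^sub>F n in sequentially. (\<integral>x. \<phi> n x \<partial>P n \<theta>0) < e / 3"
    using e by (intro order_tendstoD(2)[OF test_null]) simp
  moreover have "\<forall>\<^sub>F n in sequentially. real J < M n"
    using M by (simp add: filterlim_at_top_dense)
  ultimately show "\<forall>\<^sub>F n in sequentially.
      (\<integral>\<^sup>+x. posterior (prior n) (p n) x {\<theta>\<in>\<Theta> n. d n \<theta> \<theta>0 \<ge> M n * \<epsilon> n} \<partial>P n \<theta>0) < ennreal e"
    using rate eventually_ge_at_top[of 1]
  proof eventually_elim
    case (elim n)
    interpret dominated_experiment "\<mu> n" T "P n" "p n" using elim by (intro dominated)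
    let ?s = "real n * (\<epsilon> n)\<^sup>2"
    let ?B = "KL_ball (\<mu> n) T (p n) n \<theta>0 (\<epsilon> n) k"
    have eps: "\<epsilon> n > 0" using elim \<epsilon>_pos by simp
    \<comment> \<open>This puts the radius for the variation in \<open>KL_ball\<close> in terms of
      \<open>?s\<close> alone.\<close>
    have s_powr: "real n powr (k / 2) * \<epsilon> n powr k = ?s powr (k / 2)"
      using eps by (simp add: powr_mult powr_powr flip: powr_numeral)
    have "(\<integral>\<^sup>+x. posterior (prior n) (p n) x {\<theta>\<in>\<Theta> n. d n \<theta> \<theta>0 \<ge> M n * \<epsilon> n} \<partial>P n \<theta>0)
      \<le> ennreal ((\<integral>x. \<phi> n x \<partial>P n \<theta>0) + 2 / (C powr k * c powr (k / 2))
          + 2 * C0 * (exp (- (K * c / 4)) ^ J / (1 - exp (- (K * c / 4)))))"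
    proof (rule posterior_tail_bound[where B = ?B and s = ?s and S = "S n"])
      show "prob_space (prior n)" "sets (prior n) = sets T" using prior elim by auto
      show "{\<theta>\<in>\<Theta> n. d n \<theta> \<theta>0 \<ge> M n * \<epsilon> n} \<in> sets T" "?B \<in> sets T" "is_test (\<mu> n) (\<phi> n)"
        using tail_measurable ball_measurable test elim by auto
      show "KL (\<mu> n) (p n \<theta>0) (p n \<theta>) \<le> ereal ?s"
        and "KL_variation (\<mu> n) k (p n \<theta>0) (p n \<theta>) \<le> ereal (?s powr (k / 2))" if "\<theta> \<in> ?B" for \<theta>
        using that unfolding KL_ball_def s_powr by auto
      show "{\<theta>\<in>\<Theta> n. d n \<theta> \<theta>0 \<ge> M n * \<epsilon> n} \<subseteq> (\<Union>i. S n (i + J))"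
      proof
        fix \<theta> assume \<theta>: "\<theta> \<in> {\<theta>\<in>\<Theta> n. d n \<theta> \<theta>0 \<ge> M n * \<epsilon> n}"
        have "real J * \<epsilon> n < M n * \<epsilon> n" using elim eps by simp
        also have "\<dots> \<le> d n \<theta> \<theta>0" using \<theta> by simp
        finally show "\<theta> \<in> (\<Union>i. S n (i + J))"
          using shells_cover[OF eps J(3)] \<theta> unfolding S_def by blast
      qed
      show "(\<integral>x. 1 - \<phi> n x \<partial>P n \<theta>) \<le> C0 * exp (- K * (real j)\<^sup>2 * ?s)"
        if "j \<ge> J" "\<theta> \<in> S n j" for j \<theta>
      proof -
        have "ereal (\<integral>x. 1 - \<phi> n x \<partial>P n \<theta>) \<le> ereal (C0 * exp (- K * (real j)\<^sup>2 * real n * (\<epsilon> n)\<^sup>2))"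
          using that elim by (intro order_trans[OF SUP_upper alternative_J]) auto
        then show ?thesis by (simp add: mult_ac)
      qed
      show "emeasure (prior n) (S n j) / emeasure (prior n) ?B \<le> ennreal (exp (K * ?s * (real j)\<^sup>2 / 2))"
        if "j \<ge> J" for j
        using ratio_J[OF that, of n] elim by (simp add: mult_ac)
    qed (use \<theta>0 c k K C C0 J S_J elim in auto)
    also have "\<dots> < ennreal e"
      using elim term2 J(2) e by (intro ennreal_lessI) (auto simp: w_def r_def)
    finally show ?case .
  qed
qed

end
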